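(* Let $\mathcal{I}$ be an admissible ideal of $\mathbb{N}$, let $\{x_n\}$ be a sequence in a partial metric space $(X,p)$, and suppose $p(x,x)=a$ for all $x\in X$, where $a$ is a real constant. If $c\in X$ is an $\mathcal{I}$-cluster point of $\{x_n\}$, then $\mathcal{I}\text{-}LIM^{r}x_n\subset\overline{B^{p}_{r}}(c)$ for every $r>0$.
   Context: A partial metric on a non-empty set $X$ is a function $p: X\times X \to [0,\infty)$ such that for all $x,y,z\in X$: (p1) $0\le p(x,x)\le p(x,y)$; (p2) $x=y$ if and only if $p(x,x)=p(x,y)=p(y,y)$; (p3) $p(x,y)=p(y,x)$; (p4) $p(x,y)\le p(x,z)+p(z,y)-p(z,z)$. Then $(X,p)$ is called a partial metric space. The closed ball of radius $r>0$ and center $x\in X$ is $\overline{B^{p}_{r}}(x)=\{y\in X: p(x,y)\le p(x,x)+r\}$. An ideal of $\mathbb{N}$ is a family $\mathcal{I}\subset 2^{\mathbb{N}}$ with $\emptyset\in\mathcal{I}$, closed under finite unions and under taking subsets. It is non-trivial if $\mathbb{N}\notin\mathcal{I}$ and $\mathcal{I}\neq\{\emptyset\}$. An admissible ideal is a non-trivial ideal containing $\{n\}$ for every $n\in\mathbb{N}$. For $r\ge 0$, a sequence $\{x_n\}$ in $X$ is rough $\mathcal{I}$-convergent of roughness degree $r$ to $x\in X$ if for every $\varepsilon>0$ the set $\{n\in\mathbb{N}: |p(x_n,x)-p(x,x)|\ge r+\varepsilon\}$ belongs to $\mathcal{I}$. The rough $\mathcal{I}$-limit set $\mathcal{I}\text{-}LIM^{r}x_n$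 is the set of all $x\in X$ to which $\{x_n\}$ is rough $\mathcal{I}$-convergent of roughness degree $r$. A point $c\in X$ is an $\mathcal{I}$-cluster point of $\{x_n\}$ if for every $\varepsilon>0$, $\{n\in\mathbb{N}: |p(x_n,c)-p(c,c)|<\varepsilon\}\notin\mathcal{I}$. The symbol $\subset$ denotes (not necessarily strict) inclusion. *)

theory Defs
  imports Complex_Main
begin

definition partial_metric_on :: "'a set \<Rightarrow> ('a \<Rightarrow> 'a \<Rightarrow> real) \<Rightarrow> bool" where
  "partial_metric_on X p \<longleftrightarrow>
     X \<noteq> {} \<and>
     (\<forall>x\<in>X. \<forall>y\<in>X. 0 \<le> p x x \<and> p x x \<le> p x y) \<and>
     (\<forall>x\<in>X. \<forall>y\<in>X. x = y \<longleftrightarrow> p x x = p x y \<and> p x y = p y y) \<and>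
     (\<forall>x\<in>X. \<forall>y\<in>X. p x y = p y x) \<and>
     (\<forall>x\<in>X. \<forall>y\<in>X. \<forall>z\<in>X. p x y \<le> p x z + p z y - p z z)"

(* The radius is relative to the self-distance of the centre, which need not be 0. *)
definition pm_cball :: "'a set \<Rightarrow> ('a \<Rightarrow> 'a \<Rightarrow> real) \<Rightarrow> 'a \<Rightarrow> real \<Rightarrow> 'a set" where
  "pm_cball X p x r = {y \<in> X. p x y \<le> p x x + r}"

definition set_ideal :: "'b set set \<Rightarrow> bool" where
  "set_ideal I \<longleftrightarrow>
     {} \<in> I \<and>
     (\<forall>A\<in>I. \<forall>B\<in>I. A \<union> B \<in> I) \<and>
     (\<forall>A\<in>I. \<forall>B. B \<subseteq> A \<longrightarrow> B \<in> I)"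

definition nontrivial_ideal :: "'b set set \<Rightarrow> bool" where
  "nontrivial_ideal I \<longleftrightarrow> set_ideal I \<and> UNIV \<notin> I \<and> I \<noteq> {{}}"

definition admissible_ideal :: "'b set set \<Rightarrow> bool" where
  "admissible_ideal I \<longleftrightarrow> nontrivial_ideal I \<and> (\<forall>n. {n} \<in> I)"

(* Intended for r \<ge> 0. *)
definition rough_ideal_convergent ::
    "nat set set \<Rightarrow> ('a \<Rightarrow> 'a \<Rightarrow> real) \<Rightarrow> real \<Rightarrow> (nat \<Rightarrow> 'a) \<Rightarrow> 'a \<Rightarrow> bool" where
  "rough_ideal_convergent I p r s x \<longleftrightarrow>
     (\<forall>\<epsilon>>0. {n. \<bar>p (s n) x - p x x\<bar> \<ge> r + \<epsilon>} \<in> I)"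

definition rough_ideal_LIM ::
    "nat set set \<Rightarrow> 'a set \<Rightarrow> ('a \<Rightarrow> 'a \<Rightarrow> real) \<Rightarrow> real \<Rightarrow> (nat \<Rightarrow> 'a) \<Rightarrow> 'a set" where
  "rough_ideal_LIM I X p r s = {x \<in> X. rough_ideal_convergent I p r s x}"

definition ideal_cluster_point ::
    "nat set set \<Rightarrow> 'a set \<Rightarrow> ('a \<Rightarrow> 'a \<Rightarrow> real) \<Rightarrow> (nat \<Rightarrow> 'a) \<Rightarrow> 'a \<Rightarrow> bool" where
  "ideal_cluster_point I X p s c \<longleftrightarrow>
     c \<in> X \<and> (\<forall>\<epsilon>>0. {n. \<bar>p (s n) c - p c c\<bar> < \<epsilon>} \<notin> I)"

end

theory Submission
  imports Defs
begin

text \<open>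
  A subset of \<open>\<nat>\<close> outside the ideal cannot be covered by one inside it. So for every
  \<open>\<epsilon> > 0\<close> some term of the sequence is both within \<open>\<epsilon>\<close> of the cluster point \<open>c\<close> and
  within \<open>r + \<epsilon>\<close> of the rough limit \<open>x\<close>, distances being measured above the self-distances
  of \<open>c\<close> and \<open>x\<close>. The triangle inequality through this term \<open>z\<close> adds the two excesses; the
  correction \<open>- p z z\<close> cancels one of the two self-distances exactly because all
  self-distances agree, which leaves \<open>p c x < p c c + r + 2 * \<epsilon>\<close>. Now let \<open>\<epsilon>\<close> tend to
  \<open>0\<close>.
\<close>

theorem theorem3p9:
  fixes I :: "nat set set"
    and X :: "'a set"
    and p :: "'a \<Rightarrow> 'a \<Rightarrow> real"
    and s :: "nat \<Rightarrow> 'a"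
    and a :: real
    and c :: 'a
  assumes "admissible_ideal I"
    and "partial_metric_on X p"
    and "\<And>n. s n \<in> X"
    and "\<And>x. x \<in> X \<Longrightarrow> p x x = a"
    and "ideal_cluster_point I X p s c"
  shows "\<forall>r>0. rough_ideal_LIM I X p r s \<subseteq> pm_cball X p c r"
proof (intro allI impI subsetI)
  fix r :: real and x
  assume "x \<in> rough_ideal_LIM I X p r s"
  then have xX: "x \<in> X"
    and far_in_I: "\<And>\<epsilon>. \<epsilon> > 0 \<Longrightarrow> {n. \<bar>p (s n) x - p x x\<bar> \<ge> r + \<epsilon>} \<in> I"
    by (auto simp: rough_ideal_LIM_def rough_ideal_convergent_def)
  have cX: "c \<in> X"
    and near_notin_I: "\<And>\<epsilon>. \<epsilon> > 0 \<Longrightarrow> {n. \<bar>p (s n) c - p c c\<bar> < \<epsilon>} \<notin> I"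
    using assms(5) by (auto simp: ideal_cluster_point_def)
  have subset_closed: "\<And>A B. A \<in> I \<Longrightarrow> B \<subseteq> A \<Longrightarrow> B \<in> I"
    using assms(1) by (auto simp: admissible_ideal_def nontrivial_ideal_def set_ideal_def)
  have "p c x \<le> (a + r) + e" if "e > 0" for e
  proof -
    have "e / 2 > 0" using that by simp
    then have "\<not> {n. \<bar>p (s n) c - p c c\<bar> < e / 2} \<subseteq> {n. \<bar>p (s n) x - p x x\<bar> \<ge> r + e / 2}"
      using subset_closed far_in_I near_notin_I by blast
    then obtain n where n: "\<bar>p (s n) c - p c c\<bar> < e / 2" "\<bar>p (s n) x - p x x\<bar> < r + e / 2"
      unfolding subset_iff mem_Collect_eq not_le[symmetric] by blast
    have "p c x \<le> p c (s n) + p (s n) x - p (s n) (s n)" and "p c (s n) = p (s n) c"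
      using assms(2) assms(3)[of n] xX cX unfolding partial_metric_on_def by blast+
    then show ?thesis
      using n assms(4)[OF xX] assms(4)[OF cX] assms(4)[OF assms(3)[of n]] by linarith
  qed
  then have "p c x \<le> a + r"
    by (rule field_le_epsilon)
  then show "x \<in> pm_cball X p c r"
    using xX assms(4)[OF cX] by (simp add: pm_cball_def)
qed

end
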